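(* Let $\{\mathcal L_\alpha\}_{\alpha\in\Omega}$ be a family of simple closure spaces, $\mathcal L_\alpha$ on $\Sigma_\alpha$, let $\mathbf\Sigma=\prod_\alpha\Sigma_\alpha$, and let $T=\prod_\alpha T_\alpha$ with $T_\alpha\subseteq\mathrm{Aut}(\mathcal L_\alpha)$. Then: (1) $\underline{\bigotimes}_\alpha\mathcal L_\alpha$ and $\overline{\bigotimes}_\alpha\mathcal L_\alpha$ are simple closure spaces on $\mathbf\Sigma$. (2) $\underline{\bigotimes}_\alpha\mathcal L_\alpha$ and $\overline{\bigotimes}_\alpha\mathcal L_\alpha$ belong to $\mathcal S_T(\mathcal L_\alpha,\alpha\in\Omega)$. (3) $\mathsf S(\mathcal L_\alpha,\alpha\in\Omega)$ is exactly the set of simple closure spaces $\mathcal L$ on $\mathbf\Sigma$ such that $\underline{\bigotimes}_\alpha\mathcal L_\alpha\subseteq\mathcal L\subseteq\overline{\bigotimes}_\alpha\mathcal L_\alpha$. (4) $\mathcal S_T(\mathcal L_\alpha,\alpha\in\Omega)$ and $\mathsf S(\mathcal L_\alpha,\alpha\in\Omega)$, ordered by set-inclusion, are complete lattices.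
   Context: A simple closure space on a nonempty set $\Sigma$ is a set $\mathcal L\subseteq 2^\Sigma$, ordered by inclusion, closed under arbitrary intersections and containing $\Sigma$, $\emptyset$ and all singletons. It is a complete atomistic lattice whose atoms are the singletons; $p\in\Sigma$ is identified with $\{p\}$. $\mathrm{Aut}(\mathcal L)$ is the group of lattice automorphisms of $\mathcal L$; an automorphism $u$ sends atoms to atoms, and the induced map on $\Sigma$ is also denoted $u$. For a family $\{\Sigma_\alpha\}_{\alpha\in\Omega}$ of nonempty sets with $\mathbf\Sigma=\prod_\alpha\Sigma_\alpha$: $\pi_\beta:\mathbf\Sigma\to\Sigma_\beta$ is the coordinate map; for $p\in\mathbf\Sigma$ and $q\in\Sigma_\beta$, $p[q,\beta]$ is $p$ with its $\beta$-th entry replaced by $q$; for $B\subseteq\Sigma_\beta$, $p[B,\beta]=\{p[q,\beta]:q\in B\}$; for $R\subseteq\mathbf\Sigma$, $R_\beta[p]=\{q\in\Sigma_\beta: p[q,\beta]\in R\}$. Let $\mathcal L_\alpha$ be simple closure spaces on $\Sigma_\alpha$. $\mathsf S(\mathcal L_\alpha,\alpha\in\Omega)$ is the set of all simple closure spaces $\mathcal L$ on $\mathbf\Sigma=\prod_\alpha\Sigma_\alpha$ such that (P2) $\bigcup_\alpha\pi_\alpha^{-1}(a_\alpha)\in\mathcal L$ for all $a\in\prod_\alpha\mathcal L_\alpha$; (P3) for all $p\in\mathbf\Sigma$, $\beta\in\Omega$, $B\subseteq\Sigma_\beta$: $p[B,\beta]\in\mathcal L$ implies $B\in\mathcal L_\beta$.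 For $T=\prod_\alpha T_\alpha$ with $T_\alpha\subseteq\mathrm{Aut}(\mathcal L_\alpha)$, $\mathcal S_T(\mathcal L_\alpha,\alpha\in\Omega)$ is the set of $\mathcal L\in\mathsf S(\mathcal L_\alpha,\alpha\in\Omega)$ such that (P4) for all $v\in T$ there is $u\in\mathrm{Aut}(\mathcal L)$ with $u(p)_\alpha=v_\alpha(p_\alpha)$ for all $p\in\mathbf\Sigma$, $\alpha\in\Omega$. Finally $\underline{\bigotimes}_\alpha\mathcal L_\alpha:=\{\bigcap\omega:\ \omega\subseteq\{\bigcup_\alpha\pi_\alpha^{-1}(a_\alpha): a\in\prod_\alpha\mathcal L_\alpha\}\}$ (with $\bigcap\emptyset=\mathbf\Sigma$) and $\overline{\bigotimes}_\alpha\mathcal L_\alpha:=\{R\subseteq\mathbf\Sigma:\ R_\beta[p]\in\mathcal L_\beta\ \text{for all } p\in\mathbf\Sigma,\ \beta\in\Omega\}$, both ordered by inclusion. *)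

theory Defs
  imports "HOL-Algebra.Complete_Lattice" "HOL-Algebra.Bij" "HOL-Library.FuncSet"
begin

abbreviation inclusion_order :: "'a set set \<Rightarrow> 'a set gorder" where
  "inclusion_order L \<equiv> \<lparr>carrier = L, eq = (=), le = (\<subseteq>)\<rparr>"

definition simple_closure_space :: "'a set \<Rightarrow> 'a set set \<Rightarrow> bool" where
  "simple_closure_space X L \<longleftrightarrow>
     X \<noteq> {} \<and> L \<subseteq> Pow X \<and>
     (\<forall>W. W \<subseteq> L \<and> W \<noteq> {} \<longrightarrow> \<Inter>W \<in> L) \<and>
     X \<in> L \<and> {} \<in> L \<and> (\<forall>x\<in>X. {x} \<in> L)"

text \<open>Lattice automorphisms are extensional bijections of \<open>L\<close> (see \<^term>\<open>Bij\<close>), acting on the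
  closed sets; \<open>point_map u\<close> is the map that \<open>u\<close> induces on the points via the atoms \<open>{x}\<close>.\<close>

definition lattice_aut :: "'a set set \<Rightarrow> ('a set \<Rightarrow> 'a set) set" where
  "lattice_aut L =
     {u \<in> Bij L. join_pres (inclusion_order L) (inclusion_order L) u \<and>
                 meet_pres (inclusion_order L) (inclusion_order L) u}"

definition point_map :: "('a set \<Rightarrow> 'a set) \<Rightarrow> 'a \<Rightarrow> 'a" where
  "point_map u x = the_elem (u {x})"

text \<open>Throughout, \<open>X \<alpha>\<close> is the point set and \<open>L \<alpha>\<close> the closure space of index \<open>\<alpha> \<in> \<Omega>\<close>; products
  over \<open>\<Omega>\<close> are extensional. The point \<open>p[q,\<beta>]\<close> is \<^term>\<open>p(\<beta> := q)\<close>.\<close>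

definition slab :: "'i set \<Rightarrow> ('i \<Rightarrow> 'a set) \<Rightarrow> ('i \<Rightarrow> 'a set) \<Rightarrow> ('i \<Rightarrow> 'a) set" where
  "slab \<Omega> X a = (\<Union>\<alpha>\<in>\<Omega>. {p \<in> PiE \<Omega> X. p \<alpha> \<in> a \<alpha>})"

definition replace :: "('i \<Rightarrow> 'a) \<Rightarrow> 'a set \<Rightarrow> 'i \<Rightarrow> ('i \<Rightarrow> 'a) set" where
  "replace p B \<beta> = (\<lambda>q. p(\<beta> := q)) ` B"

definition section_at :: "('i \<Rightarrow> 'a set) \<Rightarrow> ('i \<Rightarrow> 'a) set \<Rightarrow> 'i \<Rightarrow> ('i \<Rightarrow> 'a) \<Rightarrow> 'a set" where
  "section_at X R \<beta> p = {q \<in> X \<beta>. p(\<beta> := q) \<in> R}"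

definition weak_tensors ::
    "'i set \<Rightarrow> ('i \<Rightarrow> 'a set) \<Rightarrow> ('i \<Rightarrow> 'a set set) \<Rightarrow> ('i \<Rightarrow> 'a) set set set" where
  "weak_tensors \<Omega> X L =
     {M. simple_closure_space (PiE \<Omega> X) M \<and>
         (\<forall>a \<in> PiE \<Omega> L. slab \<Omega> X a \<in> M) \<and>
         (\<forall>p \<in> PiE \<Omega> X. \<forall>\<beta>\<in>\<Omega>. \<forall>B. B \<subseteq> X \<beta> \<longrightarrow> replace p B \<beta> \<in> M \<longrightarrow> B \<in> L \<beta>)}"

definition equivariant_weak_tensors ::
    "'i set \<Rightarrow> ('i \<Rightarrow> 'a set) \<Rightarrow> ('i \<Rightarrow> 'a set set) \<Rightarrow> ('i \<Rightarrow> 'a set \<Rightarrow> 'a set) set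
      \<Rightarrow> ('i \<Rightarrow> 'a) set set set" where
  "equivariant_weak_tensors \<Omega> X L T =
     {M \<in> weak_tensors \<Omega> X L.
        \<forall>v\<in>T. \<exists>u \<in> lattice_aut M.
          \<forall>p \<in> PiE \<Omega> X. \<forall>\<alpha>\<in>\<Omega>. point_map u p \<alpha> = point_map (v \<alpha>) (p \<alpha>)}"

text \<open>Intersecting with \<^term>\<open>PiE \<Omega> X\<close> implements the convention that the empty intersection is
  the whole product.\<close>

definition lower_tensor ::
    "'i set \<Rightarrow> ('i \<Rightarrow> 'a set) \<Rightarrow> ('i \<Rightarrow> 'a set set) \<Rightarrow> ('i \<Rightarrow> 'a) set set" where
  "lower_tensor \<Omega> X L = {PiE \<Omega> X \<inter> \<Inter>W | W. W \<subseteq> slab \<Omega> X ` PiE \<Omega> L}"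

definition upper_tensor ::
    "'i set \<Rightarrow> ('i \<Rightarrow> 'a set) \<Rightarrow> ('i \<Rightarrow> 'a set set) \<Rightarrow> ('i \<Rightarrow> 'a) set set" where
  "upper_tensor \<Omega> X L =
     {R. R \<subseteq> PiE \<Omega> X \<and> (\<forall>p \<in> PiE \<Omega> X. \<forall>\<beta>\<in>\<Omega>. section_at X R \<beta> p \<in> L \<beta>)}"

end

theory Submission
  imports Defs
begin

text \<open>
  Everything rests on two facts. First, a simple closure space is rigid over its atoms: a lattice
  automorphism \<open>u\<close> permutes the singletons, hence is the direct-image map of the permutation
  \<^term>\<open>point_map u\<close>; conversely a permutation \<open>g\<close> of the points comes from an automorphism exactly when
  taking images under \<open>g\<close> maps the family of closed sets onto itself. The equivariance axiom for \<open>v\<close>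
  thereby becomes the single equation \<open>(`) g ` M = M\<close>, where \<open>g\<close> is the coordinatewise product of
  the maps \<^term>\<open>point_map (v \<alpha>)\<close>.

  Secondly, the fibre \<open>replace p (X \<beta>) \<beta>\<close>, the line through \<open>p\<close> in direction \<open>\<beta>\<close>, is an intersection
  of slabs, so it is closed in every weak tensor product \<open>M\<close>. Intersecting a closed set \<open>R\<close> with
  this line leaves a copy of the section of \<open>R\<close> at \<open>p\<close>, which the axiom on the sets \<open>replace p B \<beta>\<close>
  puts in \<open>L \<beta>\<close>. Hence \<open>M\<close> lies below the upper tensor product; it lies above the lower one because
  it contains the slabs and is closed under intersection. Conversely, a simple closure space between
  the two bounds contains the slabs, and the section of \<open>replace p B \<beta>\<close> at \<open>p\<close> is \<open>B\<close>, so membership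
  of this set in the upper tensor product forces \<open>B \<in> L \<beta>\<close>.

  The product permutation \<open>g\<close> permutes the slabs, and it carries sections to sections via the
  coordinate permutations, so both bounds are invariant. Finally, lying between the two bounds,
  being a simple closure space and satisfying \<open>(`) g ` M = M\<close> are properties of \<open>M\<close> that pass to
  intersections of nonempty collections of such \<open>M\<close>; together with the largest element this gives
  the two complete lattices.
\<close>

section \<open>Families of sets closed under intersection\<close>

text \<open>The supremum of a subfamily is the intersection of its upper bounds, and \<open>G\<close> guarantees that
  there is one.\<close>

lemma complete_lattice_inclusion_order:
  assumes top: "G \<in> F" "\<And>A. A \<in> F \<Longrightarrow> A \<subseteq> G"
    and Inter: "\<And>W. W \<subseteq> F \<Longrightarrow> W \<noteq> {} \<Longrightarrow> \<Inter>W \<in> F"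
  shows "complete_lattice (inclusion_order F)"
proof -
  interpret partial_order "inclusion_order F"
    by unfold_locales auto
  show ?thesis
  proof (rule complete_lattice_criterion1)
    show "\<exists>g. greatest (inclusion_order F) g (carrier (inclusion_order F))"
      using top by (intro exI[of _ G]) (simp add: greatest_def)
  next
    fix W assume "W \<subseteq> carrier (inclusion_order F)" "W \<noteq> {}"
    then show "\<exists>i. greatest (inclusion_order F) i (Lower (inclusion_order F) W)"
      using Inter[of W] by (intro exI[of _ "\<Inter>W"]) (auto simp: greatest_def Lower_def)
  qed
qed

lemma simple_closure_spaceD:
  assumes "simple_closure_space X M"
  shows "X \<noteq> {}" "M \<subseteq> Pow X" "X \<in> M" "{} \<in> M" "x \<in> X \<Longrightarrow> {x} \<in> M"
    and "W \<subseteq> M \<Longrightarrow> W \<noteq> {} \<Longrightarrow> \<Inter>W \<in> M"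
  using assms by (simp_all add: simple_closure_space_def)

lemma simple_closure_space_Inter:
  assumes "W \<noteq> {}" "\<And>M. M \<in> W \<Longrightarrow> simple_closure_space X M"
  shows "simple_closure_space X (\<Inter>W)"
proof -
  obtain M0 where M0: "M0 \<in> W"
    using assms(1) by blast
  have Inter: "\<Inter>V \<in> \<Inter>W" if "V \<subseteq> \<Inter>W" "V \<noteq> {}" for V
  proof
    fix M assume M: "M \<in> W"
    then have "V \<subseteq> M"
      using that by blast
    then show "\<Inter>V \<in> M"
      using assms(2)[OF M] that(2) by (simp add: simple_closure_space_def)
  qed
  have "X \<noteq> {}" "\<Inter>W \<subseteq> Pow X"
    using M0 simple_closure_spaceD[OF assms(2)[OF M0]] by auto
  moreover have "X \<in> \<Inter>W" "{} \<in> \<Inter>W" "\<forall>x\<in>X. {x} \<in> \<Inter>W"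
    using simple_closure_spaceD[OF assms(2)] by auto
  ultimately show ?thesis
    using Inter by (simp add: simple_closure_space_def)
qed

lemma simple_closure_space_Int:
  assumes "simple_closure_space X M" "A \<in> M" "B \<in> M"
  shows "A \<inter> B \<in> M"
proof -
  have "\<Inter>{A, B} \<in> M"
    using assms by (intro simple_closure_spaceD(6)) auto
  then show ?thesis by simp
qed

lemma lattice_simple_closure_space:
  assumes "simple_closure_space X M"
  shows "lattice (inclusion_order M)"
proof -
  interpret complete_lattice "inclusion_order M"
    using assms by (intro complete_lattice_inclusion_order[of X]) (auto simp: simple_closure_space_def)
  show ?thesis ..
qed

section \<open>Automorphisms and permutations of the points\<close>

lemma meet_inclusion_order:
  assumes "simple_closure_space X M" "A \<in> M" "B \<in> M"
  shows "A \<sqinter>\<^bsub>inclusion_order M\<^esub> B = A \<inter> B"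
proof -
  interpret lattice "inclusion_order M"
    by (rule lattice_simple_closure_space[OF assms(1)])
  have glb: "greatest (inclusion_order M) (A \<inter> B) (Lower (inclusion_order M) {A, B})"
    using assms simple_closure_space_Int[OF assms] by (auto simp: greatest_def Lower_def)
  show ?thesis
    unfolding meet_def inf_def by (rule some_equality, rule glb, rule greatest_unique[OF _ glb])
qed

text \<open>A join of closed sets is a closure rather than a union, so it has no formula that maps could be
  compared on. Only its universal property is used.\<close>

lemma join_inclusion_order_eq:
  assumes "simple_closure_space X M" "A \<in> M" "B \<in> M"
  shows "A \<squnion>\<^bsub>inclusion_order M\<^esub> B = C \<longleftrightarrow>
           C \<in> M \<and> A \<subseteq> C \<and> B \<subseteq> C \<and> (\<forall>D\<in>M. A \<subseteq> D \<and> B \<subseteq> D \<longrightarrow> C \<subseteq> D)"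
proof -
  interpret lattice "inclusion_order M"
    by (rule lattice_simple_closure_space[OF assms(1)])
  have "\<exists>S. least (inclusion_order M) S (Upper (inclusion_order M) {A, B})"
    by (rule sup_of_two_exists) (simp_all add: assms(2,3))
  then have lub: "least (inclusion_order M) (A \<squnion>\<^bsub>inclusion_order M\<^esub> B) (Upper (inclusion_order M) {A, B})"
    unfolding join_def sup_def by (rule someI_ex)
  have "A \<squnion>\<^bsub>inclusion_order M\<^esub> B = C \<longleftrightarrow>
      least (inclusion_order M) C (Upper (inclusion_order M) {A, B})"
  proof
    assume "least (inclusion_order M) C (Upper (inclusion_order M) {A, B})"
    with lub show "A \<squnion>\<^bsub>inclusion_order M\<^esub> B = C"
      by (rule least_unique)
  next
    assume "A \<squnion>\<^bsub>inclusion_order M\<^esub> B = C"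
    with lub show "least (inclusion_order M) C (Upper (inclusion_order M) {A, B})"
      by (rule back_subst[where P = "\<lambda>S. least (inclusion_order M) S (Upper (inclusion_order M) {A, B})"])
  qed
  also have "least (inclusion_order M) C (Upper (inclusion_order M) {A, B}) \<longleftrightarrow>
      C \<in> M \<and> A \<subseteq> C \<and> B \<subseteq> C \<and> (\<forall>D\<in>M. A \<subseteq> D \<and> B \<subseteq> D \<longrightarrow> C \<subseteq> D)"
  proof -
    have "Upper (inclusion_order M) {A, B} = {D \<in> M. A \<subseteq> D \<and> B \<subseteq> D}"
      unfolding Upper_def using assms(2,3) by auto
    then show ?thesis
      by (auto simp: least_def)
  qed
  finally show ?thesis .
qed

text \<open>Since \<open>A \<subseteq> B\<close> means \<open>A \<inter> B = A\<close>, an injective map preserving meets preserves and reflects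
  inclusion. Conversely, meets and joins are determined by the order, which an order automorphism
  transports.\<close>

lemma lattice_aut_iff_order_automorphism:
  assumes M: "simple_closure_space X M"
  shows "u \<in> lattice_aut M \<longleftrightarrow>
           u \<in> Bij M \<and> (\<forall>A\<in>M. \<forall>B\<in>M. u A \<subseteq> u B \<longleftrightarrow> A \<subseteq> B)"
proof
  assume u: "u \<in> lattice_aut M"
  then have bij: "u \<in> Bij M"
    by (simp add: lattice_aut_def)
  have "u A \<subseteq> u B \<longleftrightarrow> A \<subseteq> B" if AB: "A \<in> M" "B \<in> M" for A B
  proof -
    have "A \<inter> B \<in> M"
      using M AB by (rule simple_closure_space_Int)
    moreover have "u A \<in> M" "u B \<in> M"
      using bij AB by (auto simp: Bij_def bij_betw_def)
    then have "u (A \<inter> B) = u A \<inter> u B"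
      using u AB by (simp add: lattice_aut_def meet_pres_def meet_inclusion_order[OF M])
    moreover have "inj_on u M"
      using bij by (simp add: Bij_def bij_betw_def)
    ultimately have "u A \<inter> u B = u A \<longleftrightarrow> A \<inter> B = A"
      using AB inj_on_eq_iff[of u M "A \<inter> B" A] by simp
    then show ?thesis
      by (simp add: inf.absorb_iff1)
  qed
  with bij show "u \<in> Bij M \<and> (\<forall>A\<in>M. \<forall>B\<in>M. u A \<subseteq> u B \<longleftrightarrow> A \<subseteq> B)"
    by blast
next
  assume u: "u \<in> Bij M \<and> (\<forall>A\<in>M. \<forall>B\<in>M. u A \<subseteq> u B \<longleftrightarrow> A \<subseteq> B)"
  then have im: "u ` M = M"
    by (simp add: Bij_def bij_betw_def)
  have mem: "u A \<in> M" if "A \<in> M" for A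
    using im that by blast
  have ord: "u A \<subseteq> u B \<longleftrightarrow> A \<subseteq> B" if "A \<in> M" "B \<in> M" for A B
    using u that by blast
  have "u (A \<squnion>\<^bsub>inclusion_order M\<^esub> B) = u A \<squnion>\<^bsub>inclusion_order M\<^esub> u B"
    if AB: "A \<in> M" "B \<in> M" for A B
  proof -
    define C where "C = A \<squnion>\<^bsub>inclusion_order M\<^esub> B"
    have C: "C \<in> M" "A \<subseteq> C" "B \<subseteq> C" and least: "\<And>D. D \<in> M \<Longrightarrow> A \<subseteq> D \<Longrightarrow> B \<subseteq> D \<Longrightarrow> C \<subseteq> D"
      using iffD1[OF join_inclusion_order_eq[OF M AB] C_def[symmetric]] by blast+
    have "u C \<subseteq> E" if E: "E \<in> M" "u A \<subseteq> E" "u B \<subseteq> E" for E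
    proof -
      obtain D where D: "D \<in> M" "E = u D"
        using im E(1) by blast
      then have "A \<subseteq> D" "B \<subseteq> D"
        using ord AB E by blast+
      then show ?thesis
        using ord[OF C(1) D(1)] least[OF D(1)] D(2) by simp
    qed
    moreover have "u A \<subseteq> u C" "u B \<subseteq> u C"
      using ord AB C by blast+
    ultimately have "u A \<squnion>\<^bsub>inclusion_order M\<^esub> u B = u C"
      using mem[OF C(1)]
      by (intro iffD2[OF join_inclusion_order_eq[OF M mem[OF AB(1)] mem[OF AB(2)]]] conjI ballI impI) simp_all
    then show ?thesis by (simp add: C_def)
  qed
  moreover have "u (A \<inter> B) = u A \<inter> u B" if AB: "A \<in> M" "B \<in> M" for A B
  proof (rule antisym)
    note I = simple_closure_space_Int[OF M]
    show "u (A \<inter> B) \<subseteq> u A \<inter> u B"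
      using ord[OF I[OF AB]] AB by simp
    obtain D where D: "D \<in> M" "u A \<inter> u B = u D"
      using im I[OF mem mem, OF AB] by blast
    then have "D \<subseteq> A \<inter> B"
      using ord[OF D(1)] AB by (metis Int_lower1 Int_lower2 Int_greatest)
    then show "u A \<inter> u B \<subseteq> u (A \<inter> B)"
      using ord[OF D(1) I[OF AB]] D(2) by simp
  qed
  ultimately show "u \<in> lattice_aut M"
    using u mem lattice_simple_closure_space[OF M]
    by (simp add: lattice_aut_def join_pres_def meet_pres_def meet_inclusion_order[OF M])
qed

text \<open>An order automorphism fixes the least closed set, the empty set, and so permutes the minimal
  nonempty closed sets, which are the singletons. A closed set is determined by the singletons below
  it, which makes the automorphism a direct image.\<close>

lemma lattice_aut_is_image:
  assumes M: "simple_closure_space X M" and u: "u \<in> lattice_aut M"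
  shows "bij_betw (point_map u) X X" and "A \<in> M \<Longrightarrow> u A = point_map u ` A"
proof -
  have ord: "u A \<subseteq> u B \<longleftrightarrow> A \<subseteq> B" if "A \<in> M" "B \<in> M" for A B
    using u that by (simp add: lattice_aut_iff_order_automorphism[OF M])
  have im: "u ` M = M"
    using u by (simp add: lattice_aut_def Bij_def bij_betw_def)
  have sub: "A \<subseteq> X" if "A \<in> M" for A
    using simple_closure_spaceD(2)[OF M] that by blast
  have emp: "{} \<in> M" and sing: "\<And>x. x \<in> X \<Longrightarrow> {x} \<in> M"
    using simple_closure_spaceD[OF M] by simp_all
  have u_empty: "u A = {} \<longleftrightarrow> A = {}" if A: "A \<in> M" for A
  proof -
    obtain D where "D \<in> M" "u D = {}"
      using im emp by (metis imageE)
    then have "u {} = {}"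
      using ord[OF emp] by auto
    then show ?thesis
      using ord[OF A emp] by auto
  qed
  have u_sing: "u {x} = {point_map u x} \<and> point_map u x \<in> X" if x: "x \<in> X" for x
  proof -
    have "u {x} \<in> M"
      using im sing[OF x] by blast
    moreover obtain y where y: "y \<in> u {x}"
      using u_empty[OF sing[OF x]] by auto
    ultimately have yX: "y \<in> X"
      using sub by blast
    obtain D where D: "D \<in> M" "u D = {y}"
      using im sing[OF yX] by (metis imageE)
    then have "D \<subseteq> {x}" "D \<noteq> {}"
      using ord[OF D(1) sing[OF x]] u_empty y by auto
    then have "D = {x}" by auto
    then show ?thesis
      using D yX by (simp add: point_map_def)
  qed
  have surj: "\<exists>x\<in>X. point_map u x = y" if y: "y \<in> X" for y
  proof -
    obtain D where D: "D \<in> M" "u D = {y}"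
      using im sing[OF y] by (metis imageE)
    then obtain x where x: "x \<in> D"
      using u_empty by blast
    then have "x \<in> X"
      using sub D by blast
    moreover have "u {x} \<subseteq> {y}"
      using ord[OF sing D(1)] D x calculation by auto
    ultimately show ?thesis
      using u_sing by auto
  qed
  have inj: "inj_on (point_map u) X"
  proof (rule inj_onI)
    fix x y assume "x \<in> X" "y \<in> X" "point_map u x = point_map u y"
    then show "x = y"
      using u_sing ord[OF sing sing] by auto
  qed
  show "bij_betw (point_map u) X X"
    using inj surj u_sing by (auto simp: bij_betw_def)
  show "u A = point_map u ` A" if A: "A \<in> M"
  proof (rule Set.set_eqI)
    fix y
    have "u A \<in> M"
      using im A by blast
    then have "y \<in> X" if "y \<in> u A"
      using sub that by blast
    moreover have mem: "point_map u x \<in> u A \<longleftrightarrow> x \<in> A" if "x \<in> X" for x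
      using ord[OF sing[OF that] A] u_sing[OF that] by auto
    ultimately show "y \<in> u A \<longleftrightarrow> y \<in> point_map u ` A"
      using surj[of y] sub[OF A] by (auto simp: image_iff)
  qed
qed

lemma lattice_aut_image_closed_sets:
  assumes "simple_closure_space X M" "u \<in> lattice_aut M"
  shows "(`) (point_map u) ` M = M"
proof -
  have "(`) (point_map u) ` M = u ` M"
    using lattice_aut_is_image(2)[OF assms] by (intro image_cong) auto
  also have "\<dots> = M"
    using assms(2) by (simp add: lattice_aut_def Bij_def bij_betw_def)
  finally show ?thesis .
qed

text \<open>The only candidate for an automorphism with point map \<open>g\<close> is the direct image under \<open>g\<close>. It
  respects inclusion in both directions because \<open>g\<close> is injective, so the one remaining condition is
  that it maps the closed sets onto the closed sets.\<close>

lemma lattice_aut_inducing_iff: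
  assumes M: "simple_closure_space X M" and g: "bij_betw g X X"
  shows "(\<exists>u\<in>lattice_aut M. \<forall>p\<in>X. point_map u p = g p) \<longleftrightarrow> (`) g ` M = M"
proof
  assume "\<exists>u\<in>lattice_aut M. \<forall>p\<in>X. point_map u p = g p"
  then obtain u where u: "u \<in> lattice_aut M" "\<forall>p\<in>X. point_map u p = g p" ..
  have "(`) g ` M = (`) (point_map u) ` M"
    using simple_closure_spaceD(2)[OF M] u(2) by (intro image_cong refl) (metis PowD subsetD)
  then show "(`) g ` M = M"
    using lattice_aut_image_closed_sets[OF M u(1)] by simp
next
  assume gM: "(`) g ` M = M"
  define u where "u = restrict ((`) g) M"
  have sub: "M \<subseteq> Pow X"
    using M by (rule simple_closure_spaceD(2))
  have inj: "inj_on g X"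
    using g by (rule bij_betw_imp_inj_on)
  have ord: "g ` A \<subseteq> g ` B \<longleftrightarrow> A \<subseteq> B" if "A \<in> M" "B \<in> M" for A B
  proof -
    have "A \<subseteq> X" "B \<subseteq> X"
      using that sub by auto
    then have "g x \<in> g ` B \<longleftrightarrow> x \<in> B" if "x \<in> A" for x
      using that by (intro inj_on_image_mem_iff[OF inj]) blast+
    then show ?thesis
      unfolding image_subset_iff by (simp add: subset_eq)
  qed
  have "inj_on ((`) g) M"
    using inj_on_image_Pow[OF inj] sub by (rule inj_on_subset)
  then have "bij_betw ((`) g) M M"
    using gM by (rule bij_betw_imageI)
  then have "u \<in> Bij M"
    by (simp add: u_def Bij_def cong: bij_betw_cong)
  then have "u \<in> lattice_aut M"
    using ord by (simp add: lattice_aut_iff_order_automorphism[OF M] u_def)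
  moreover have "point_map u p = g p" if "p \<in> X" for p
    using simple_closure_spaceD(5)[OF M that] by (simp add: point_map_def u_def)
  ultimately show "\<exists>u\<in>lattice_aut M. \<forall>p\<in>X. point_map u p = g p" by blast
qed

text \<open>A permutation of \<open>X\<close> permutes the subsets of \<open>X\<close>, so invariance can be tested in both
  directions on a single subset.\<close>

lemma image_family_eq_iff:
  assumes g: "bij_betw g X X" and M: "M \<subseteq> Pow X"
  shows "(`) g ` M = M \<longleftrightarrow> (\<forall>R\<subseteq>X. g ` R \<in> M \<longleftrightarrow> R \<in> M)"
proof -
  have bij: "bij_betw ((`) g) (Pow X) (Pow X)"
    using g by (rule bij_betw_image_Pow)
  have mem: "g ` R \<in> (`) g ` M \<longleftrightarrow> R \<in> M" if "R \<subseteq> X" for R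
  proof (rule inj_on_image_mem_iff)
    show "inj_on ((`) g) (Pow X)"
      using bij by (rule bij_betw_imp_inj_on)
    show "R \<in> Pow X"
      using that by simp
  qed (rule M)
  show ?thesis
  proof
    assume gM: "(`) g ` M = M"
    show "\<forall>R\<subseteq>X. g ` R \<in> M \<longleftrightarrow> R \<in> M"
      using mem unfolding gM by blast
  next
    assume iff: "\<forall>R\<subseteq>X. g ` R \<in> M \<longleftrightarrow> R \<in> M"
    show "(`) g ` M = M"
    proof (intro subset_antisym subsetI)
      fix S assume "S \<in> (`) g ` M"
      then obtain R where R: "R \<in> M" "S = g ` R" by blast
      then have "R \<subseteq> X"
        using M by blast
      then show "S \<in> M"
        using iff R by simp
    next
      fix S assume S: "S \<in> M"
      then have "S \<in> (`) g ` Pow X"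
        using M bij_betw_imp_surj_on[OF bij] by auto
      then obtain R where R: "R \<subseteq> X" "S = g ` R" by blast
      then have "R \<in> M"
        using iff S by simp
      then show "S \<in> (`) g ` M"
        using R(2) by (rule rev_image_eqI)
    qed
  qed
qed

section \<open>Slabs and sections\<close>

lemma slab_subset: "slab \<Omega> X a \<subseteq> PiE \<Omega> X"
  by (auto simp: slab_def)

lemma fun_upd_in_PiE:
  assumes "p \<in> PiE \<Omega> X" "\<beta> \<in> \<Omega>" "q \<in> X \<beta>"
  shows "p(\<beta> := q) \<in> PiE \<Omega> X"
  using assms by (auto simp: PiE_iff extensional_def)

lemma section_at_Inter:
  assumes "W \<noteq> {}"
  shows "section_at X (\<Inter>W) \<beta> p = (\<Inter>R\<in>W. section_at X R \<beta> p)"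
  using assms by (auto simp: section_at_def)

text \<open>Moving along the line in direction \<open>\<beta>\<close> leaves the other coordinates of \<open>p\<close> unchanged: if one of
  them already puts \<open>p\<close> into the slab, the whole line lies in it, and otherwise only the coordinate
  at \<open>\<beta>\<close> decides.\<close>

lemma section_at_slab:
  assumes "p \<in> PiE \<Omega> X" "\<beta> \<in> \<Omega>" "a \<beta> \<subseteq> X \<beta>"
  shows "section_at X (slab \<Omega> X a) \<beta> p =
           (if \<exists>\<alpha>\<in>\<Omega> - {\<beta>}. p \<alpha> \<in> a \<alpha> then X \<beta> else a \<beta>)"
proof -
  have "p(\<beta> := q) \<in> slab \<Omega> X a \<longleftrightarrow> (\<exists>\<alpha>\<in>\<Omega> - {\<beta>}. p \<alpha> \<in> a \<alpha>) \<or> q \<in> a \<beta>" if "q \<in> X \<beta>" for q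
    using fun_upd_in_PiE[OF assms(1,2) that] assms(2) by (auto simp: slab_def)
  then show ?thesis
    using assms(3) by (auto simp: section_at_def)
qed

lemma replace_subset:
  assumes "p \<in> PiE \<Omega> X" "\<beta> \<in> \<Omega>" "B \<subseteq> X \<beta>"
  shows "replace p B \<beta> \<subseteq> PiE \<Omega> X"
  using fun_upd_in_PiE[OF assms(1,2)] assms(3) by (auto simp: replace_def)

lemma section_at_replace:
  assumes "B \<subseteq> X \<beta>"
  shows "section_at X (replace p B \<beta>) \<beta> p = B"
  using assms by (auto simp: section_at_def replace_def dest: fun_upd_eqD)

lemma replace_section_at:
  "replace p (section_at X R \<beta> p) \<beta> = R \<inter> replace p (X \<beta>) \<beta>"
  by (auto simp: replace_def section_at_def)

section \<open>The two bounds\<close>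

locale closure_space_family =
  fixes \<Omega> :: "'i set" and X :: "'i \<Rightarrow> 'a set" and L :: "'i \<Rightarrow> 'a set set"
  assumes closure_space: "\<And>\<alpha>. \<alpha> \<in> \<Omega> \<Longrightarrow> simple_closure_space (X \<alpha>) (L \<alpha>)"
begin

lemma closed_sets:
  assumes "\<alpha> \<in> \<Omega>"
  shows "X \<alpha> \<noteq> {}" "L \<alpha> \<subseteq> Pow (X \<alpha>)" "X \<alpha> \<in> L \<alpha>" "{} \<in> L \<alpha>" "\<And>x. x \<in> X \<alpha> \<Longrightarrow> {x} \<in> L \<alpha>"
  using simple_closure_spaceD(1-5)[OF closure_space[OF assms]] by auto

lemma PiE_nonempty: "PiE \<Omega> X \<noteq> {}"
  using closed_sets(1) by (simp add: PiE_eq_empty_iff)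

lemma upper_tensor_closure_space: "simple_closure_space (PiE \<Omega> X) (upper_tensor \<Omega> X L)"
  unfolding simple_closure_space_def
proof (intro conjI allI impI ballI)
  fix W assume W: "W \<subseteq> upper_tensor \<Omega> X L \<and> W \<noteq> {}"
  then have "\<Inter>W \<subseteq> PiE \<Omega> X"
    by (auto simp: upper_tensor_def)
  moreover have "section_at X (\<Inter>W) \<beta> p \<in> L \<beta>" if "p \<in> PiE \<Omega> X" "\<beta> \<in> \<Omega>" for p \<beta>
  proof -
    have "(\<Inter>R\<in>W. section_at X R \<beta> p) \<in> L \<beta>"
      using W that by (intro simple_closure_spaceD(6)[OF closure_space]) (auto simp: upper_tensor_def)
    then show ?thesis
      using W by (simp add: section_at_Inter)
  qed
  ultimately show "\<Inter>W \<in> upper_tensor \<Omega> X L"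
    by (simp add: upper_tensor_def)
next
  fix r assume r: "r \<in> PiE \<Omega> X"
  have "section_at X {r} \<beta> p \<in> L \<beta>" if "p \<in> PiE \<Omega> X" "\<beta> \<in> \<Omega>" for p \<beta>
  proof -
    have "section_at X {r} \<beta> p \<subseteq> {r \<beta>}"
      by (auto simp: section_at_def)
    then show ?thesis
      using closed_sets(4,5)[OF that(2)] PiE_mem[OF r that(2)] by (auto dest: subset_singletonD)
  qed
  then show "{r} \<in> upper_tensor \<Omega> X L"
    using r by (auto simp: upper_tensor_def)
next
  have "section_at X (PiE \<Omega> X) \<beta> p = X \<beta>" if "p \<in> PiE \<Omega> X" "\<beta> \<in> \<Omega>" for p \<beta>
    using fun_upd_in_PiE[OF that] by (auto simp: section_at_def)
  then show "PiE \<Omega> X \<in> upper_tensor \<Omega> X L"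
    using closed_sets by (auto simp: upper_tensor_def)
qed (use PiE_nonempty closed_sets in \<open>auto simp: upper_tensor_def section_at_def\<close>)

lemma slab_in_upper_tensor:
  assumes "a \<in> PiE \<Omega> L"
  shows "slab \<Omega> X a \<in> upper_tensor \<Omega> X L"
proof -
  have "section_at X (slab \<Omega> X a) \<beta> p \<in> L \<beta>" if "p \<in> PiE \<Omega> X" "\<beta> \<in> \<Omega>" for p \<beta>
  proof -
    have a: "a \<beta> \<in> L \<beta>"
      using assms that(2) by (rule PiE_mem)
    then have "a \<beta> \<subseteq> X \<beta>"
      using closed_sets(2)[OF that(2)] by blast
    then show ?thesis
      using section_at_slab[OF that, of a] closed_sets(3)[OF that(2)] a by simp
  qed
  then show ?thesis
    by (simp add: upper_tensor_def slab_subset)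
qed

lemma lower_tensorI:
  assumes "W \<subseteq> slab \<Omega> X ` PiE \<Omega> L"
  shows "PiE \<Omega> X \<inter> \<Inter>W \<in> lower_tensor \<Omega> X L"
  using assms by (auto simp: lower_tensor_def)

lemma slab_in_lower_tensor:
  assumes "a \<in> PiE \<Omega> L"
  shows "slab \<Omega> X a \<in> lower_tensor \<Omega> X L"
proof -
  have "slab \<Omega> X a = PiE \<Omega> X \<inter> \<Inter>{slab \<Omega> X a}"
    using slab_subset[of \<Omega> X a] by (simp add: Int_absorb1)
  then show ?thesis
    using assms unfolding lower_tensor_def by blast
qed

lemma lower_tensor_subset:
  assumes M: "simple_closure_space (PiE \<Omega> X) M" and slabs: "slab \<Omega> X ` PiE \<Omega> L \<subseteq> M"
  shows "lower_tensor \<Omega> X L \<subseteq> M"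
proof
  fix R assume "R \<in> lower_tensor \<Omega> X L"
  then obtain W where W: "W \<subseteq> slab \<Omega> X ` PiE \<Omega> L" "R = \<Inter>(insert (PiE \<Omega> X) W)"
    by (auto simp: lower_tensor_def)
  moreover have "insert (PiE \<Omega> X) W \<subseteq> M"
    using W(1) slabs simple_closure_spaceD(3)[OF M] by blast
  ultimately show "R \<in> M"
    using simple_closure_spaceD(6)[OF M] by blast
qed

lemma lower_tensor_subset_upper_tensor: "lower_tensor \<Omega> X L \<subseteq> upper_tensor \<Omega> X L"
  using lower_tensor_subset[OF upper_tensor_closure_space] slab_in_upper_tensor by blast

lemma lower_tensor_Inter:
  assumes "W \<subseteq> lower_tensor \<Omega> X L"
  shows "PiE \<Omega> X \<inter> \<Inter>W \<in> lower_tensor \<Omega> X L"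
proof -
  have "\<forall>R\<in>W. \<exists>V. V \<subseteq> slab \<Omega> X ` PiE \<Omega> L \<and> R = PiE \<Omega> X \<inter> \<Inter>V"
    using assms by (auto simp: lower_tensor_def)
  then obtain V where V: "\<forall>R\<in>W. V R \<subseteq> slab \<Omega> X ` PiE \<Omega> L \<and> R = PiE \<Omega> X \<inter> \<Inter>(V R)"
    by metis
  then have "\<Union>(V ` W) \<subseteq> slab \<Omega> X ` PiE \<Omega> L"
    by blast
  moreover have "PiE \<Omega> X \<inter> \<Inter>W = PiE \<Omega> X \<inter> \<Inter>(\<Union>(V ` W))"
  proof -
    have "x \<in> \<Inter>W \<longleftrightarrow> x \<in> \<Inter>(\<Union>(V ` W))" if "x \<in> PiE \<Omega> X" for x
    proof -
      have "x \<in> R \<longleftrightarrow> x \<in> \<Inter>(V R)" if "R \<in> W" for R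
        using V \<open>x \<in> PiE \<Omega> X\<close> that by (metis IntD2 IntI)
      then show ?thesis by auto
    qed
    then show ?thesis by blast
  qed
  ultimately show ?thesis
    unfolding lower_tensor_def by blast
qed

text \<open>The slab whose only nonempty component is \<open>A\<close> at \<open>\<beta>\<close> is the cylinder over \<open>A\<close>.\<close>

lemma cylinder_in_lower_tensor:
  assumes "\<beta> \<in> \<Omega>" "A \<in> L \<beta>"
  shows "{r \<in> PiE \<Omega> X. r \<beta> \<in> A} \<in> lower_tensor \<Omega> X L"
proof -
  let ?a = "\<lambda>\<alpha>\<in>\<Omega>. if \<alpha> = \<beta> then A else {}"
  have "?a \<in> PiE \<Omega> L"
    using assms closed_sets by auto
  moreover have "slab \<Omega> X ?a = {r \<in> PiE \<Omega> X. r \<beta> \<in> A}"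
    using assms by (auto simp: slab_def split: if_splits)
  ultimately show ?thesis
    using slab_in_lower_tensor by metis
qed

text \<open>Taking \<open>J\<close> to be the whole index set yields the singletons, and omitting one index yields the
  lines in the direction of that index.\<close>

lemma partial_point_in_lower_tensor:
  assumes "p \<in> PiE \<Omega> X" "J \<subseteq> \<Omega>"
  shows "{r \<in> PiE \<Omega> X. \<forall>\<alpha>\<in>J. r \<alpha> = p \<alpha>} \<in> lower_tensor \<Omega> X L"
proof -
  let ?C = "\<lambda>\<alpha>. {r \<in> PiE \<Omega> X. r \<alpha> \<in> {p \<alpha>}}"
  have "?C ` J \<subseteq> lower_tensor \<Omega> X L"
  proof (rule image_subsetI)
    fix \<alpha> assume "\<alpha> \<in> J"
    then have "\<alpha> \<in> \<Omega>"
      using assms(2) by blast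
    then show "?C \<alpha> \<in> lower_tensor \<Omega> X L"
      by (rule cylinder_in_lower_tensor) (rule closed_sets(5)[OF \<open>\<alpha> \<in> \<Omega>\<close> PiE_mem[OF assms(1) \<open>\<alpha> \<in> \<Omega>\<close>]])
  qed
  then have "PiE \<Omega> X \<inter> \<Inter>(?C ` J) \<in> lower_tensor \<Omega> X L"
    by (rule lower_tensor_Inter)
  moreover have "PiE \<Omega> X \<inter> \<Inter>(?C ` J) = {r \<in> PiE \<Omega> X. \<forall>\<alpha>\<in>J. r \<alpha> = p \<alpha>}"
    by auto
  ultimately show ?thesis by metis
qed

lemma line_in_lower_tensor:
  assumes p: "p \<in> PiE \<Omega> X" and \<beta>: "\<beta> \<in> \<Omega>"
  shows "replace p (X \<beta>) \<beta> \<in> lower_tensor \<Omega> X L"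
proof -
  have "replace p (X \<beta>) \<beta> = {r \<in> PiE \<Omega> X. \<forall>\<alpha>\<in>\<Omega> - {\<beta>}. r \<alpha> = p \<alpha>}"
  proof (intro subset_antisym subsetI)
    fix r assume "r \<in> replace p (X \<beta>) \<beta>"
    then show "r \<in> {r \<in> PiE \<Omega> X. \<forall>\<alpha>\<in>\<Omega> - {\<beta>}. r \<alpha> = p \<alpha>}"
      using replace_subset[OF p \<beta> subset_refl] by (auto simp: replace_def split: if_splits)
  next
    fix r assume r: "r \<in> {r \<in> PiE \<Omega> X. \<forall>\<alpha>\<in>\<Omega> - {\<beta>}. r \<alpha> = p \<alpha>}"
    have "r = p(\<beta> := r \<beta>)"
    proof
      fix \<alpha> show "r \<alpha> = (p(\<beta> := r \<beta>)) \<alpha>"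
        using r PiE_arb[of r \<Omega> X \<alpha>] PiE_arb[OF p, of \<alpha>] by (cases "\<alpha> = \<beta>"; cases "\<alpha> \<in> \<Omega>") simp_all
    qed
    moreover have "r \<beta> \<in> X \<beta>"
      using r \<beta> by auto
    ultimately show "r \<in> replace p (X \<beta>) \<beta>"
      unfolding replace_def by blast
  qed
  then show ?thesis
    using partial_point_in_lower_tensor[OF p, of "\<Omega> - {\<beta>}"] by simp
qed

lemma lower_tensor_closure_space: "simple_closure_space (PiE \<Omega> X) (lower_tensor \<Omega> X L)"
  unfolding simple_closure_space_def
proof (intro conjI allI impI ballI)
  fix W assume W: "W \<subseteq> lower_tensor \<Omega> X L \<and> W \<noteq> {}"
  moreover have "\<Inter>W \<subseteq> PiE \<Omega> X"
    using W by (auto simp: lower_tensor_def)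
  ultimately show "\<Inter>W \<in> lower_tensor \<Omega> X L"
    using lower_tensor_Inter[of W] by (simp add: Int_absorb1)
next
  fix p assume p: "p \<in> PiE \<Omega> X"
  have "{r \<in> PiE \<Omega> X. \<forall>\<alpha>\<in>\<Omega>. r \<alpha> = p \<alpha>} = {p}"
    using p by (auto intro: PiE_ext)
  then show "{p} \<in> lower_tensor \<Omega> X L"
    using partial_point_in_lower_tensor[OF p, of \<Omega>] by simp
next
  show "PiE \<Omega> X \<in> lower_tensor \<Omega> X L"
    using lower_tensor_Inter[of "{}"] by simp
next
  have "slab \<Omega> X (\<lambda>\<alpha>\<in>\<Omega>. {}) = {}"
    by (auto simp: slab_def)
  then show "{} \<in> lower_tensor \<Omega> X L"
    using slab_in_lower_tensor[of "\<lambda>\<alpha>\<in>\<Omega>. {}"] closed_sets by auto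
qed (use PiE_nonempty in \<open>auto simp: lower_tensor_def\<close>)

text \<open>Lines are closed, so the trace of a closed set on a line is closed; the third condition in the
  definition of weak tensor products then says that the corresponding section is closed in \<open>L \<beta>\<close>.\<close>

lemma weak_tensor_subset_upper_tensor:
  assumes M: "M \<in> weak_tensors \<Omega> X L"
  shows "M \<subseteq> upper_tensor \<Omega> X L"
proof
  fix R assume R: "R \<in> M"
  have sp: "simple_closure_space (PiE \<Omega> X) M"
    using M by (simp add: weak_tensors_def)
  have "section_at X R \<beta> p \<in> L \<beta>" if p: "p \<in> PiE \<Omega> X" and \<beta>: "\<beta> \<in> \<Omega>" for p \<beta>
  proof -
    have "lower_tensor \<Omega> X L \<subseteq> M"
      using lower_tensor_subset[OF sp] M by (auto simp: weak_tensors_def)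
    then have "replace p (X \<beta>) \<beta> \<in> M"
      using line_in_lower_tensor[OF p \<beta>] by blast
    then have "replace p (section_at X R \<beta> p) \<beta> \<in> M"
      using simple_closure_space_Int[OF sp R] by (simp add: replace_section_at)
    moreover have "section_at X R \<beta> p \<subseteq> X \<beta>"
      by (auto simp: section_at_def)
    ultimately show ?thesis
      using M p \<beta> by (auto simp: weak_tensors_def)
  qed
  moreover have "R \<subseteq> PiE \<Omega> X"
    using simple_closure_spaceD(2)[OF sp] R by blast
  ultimately show "R \<in> upper_tensor \<Omega> X L"
    by (simp add: upper_tensor_def)
qed

text \<open>In the converse direction, a closed set \<open>replace p B \<beta>\<close> belongs to the upper tensor product, so
  its section at \<open>p\<close>, which is \<open>B\<close>, is closed in \<open>L \<beta>\<close>.\<close>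

lemma weak_tensors_eq_interval:
  "weak_tensors \<Omega> X L =
     {M. simple_closure_space (PiE \<Omega> X) M \<and>
         lower_tensor \<Omega> X L \<subseteq> M \<and> M \<subseteq> upper_tensor \<Omega> X L}"
proof (intro subset_antisym subsetI)
  fix M assume M: "M \<in> weak_tensors \<Omega> X L"
  then have "simple_closure_space (PiE \<Omega> X) M" "slab \<Omega> X ` PiE \<Omega> L \<subseteq> M"
    by (auto simp: weak_tensors_def)
  then show "M \<in> {M. simple_closure_space (PiE \<Omega> X) M \<and>
         lower_tensor \<Omega> X L \<subseteq> M \<and> M \<subseteq> upper_tensor \<Omega> X L}"
    using lower_tensor_subset weak_tensor_subset_upper_tensor[OF M] by blast
next
  fix M assume "M \<in> {M. simple_closure_space (PiE \<Omega> X) M \<and>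
         lower_tensor \<Omega> X L \<subseteq> M \<and> M \<subseteq> upper_tensor \<Omega> X L}"
  then have sp: "simple_closure_space (PiE \<Omega> X) M" and lo: "lower_tensor \<Omega> X L \<subseteq> M"
    and up: "M \<subseteq> upper_tensor \<Omega> X L" by auto
  have "B \<in> L \<beta>" if "p \<in> PiE \<Omega> X" "\<beta> \<in> \<Omega>" "B \<subseteq> X \<beta>" "replace p B \<beta> \<in> M" for p \<beta> B
  proof -
    have "section_at X (replace p B \<beta>) \<beta> p \<in> L \<beta>"
      using that up by (auto simp: upper_tensor_def)
    then show ?thesis
      using that(3) by (simp add: section_at_replace)
  qed
  then show "M \<in> weak_tensors \<Omega> X L"
    using sp lo slab_in_lower_tensor by (auto simp: weak_tensors_def)
qed

lemma upper_tensor_is_weak_tensor: "upper_tensor \<Omega> X L \<in> weak_tensors \<Omega> X L"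
  using upper_tensor_closure_space lower_tensor_subset_upper_tensor
  by (simp add: weak_tensors_eq_interval)

lemma lower_tensor_is_weak_tensor: "lower_tensor \<Omega> X L \<in> weak_tensors \<Omega> X L"
  using lower_tensor_closure_space lower_tensor_subset_upper_tensor
  by (simp add: weak_tensors_eq_interval)

lemma weak_tensors_Inter:
  assumes "W \<subseteq> weak_tensors \<Omega> X L" "W \<noteq> {}"
  shows "\<Inter>W \<in> weak_tensors \<Omega> X L"
proof -
  have "simple_closure_space (PiE \<Omega> X) (\<Inter>W)"
    using assms by (intro simple_closure_space_Inter) (auto simp: weak_tensors_def)
  then show ?thesis
    using assms unfolding weak_tensors_eq_interval by fast
qed

end

section \<open>Product permutations\<close>

definition product_map :: "'i set \<Rightarrow> ('i \<Rightarrow> 'a \<Rightarrow> 'a) \<Rightarrow> ('i \<Rightarrow> 'a) \<Rightarrow> 'i \<Rightarrow> 'a" where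
  "product_map \<Omega> f p = (\<lambda>\<alpha>\<in>\<Omega>. f \<alpha> (p \<alpha>))"

lemma bij_betw_product_map:
  assumes "\<And>\<alpha>. \<alpha> \<in> \<Omega> \<Longrightarrow> bij_betw (f \<alpha>) (X \<alpha>) (X \<alpha>)"
  shows "bij_betw (product_map \<Omega> f) (PiE \<Omega> X) (PiE \<Omega> X)"
proof (rule bij_betwI[where g = "product_map \<Omega> (\<lambda>\<alpha>. inv_into (X \<alpha>) (f \<alpha>))"])
  have "f \<alpha> (p \<alpha>) \<in> X \<alpha>" "inv_into (X \<alpha>) (f \<alpha>) (p \<alpha>) \<in> X \<alpha>"
    if "p \<in> PiE \<Omega> X" "\<alpha> \<in> \<Omega>" for p \<alpha>
    using bij_betwE[OF assms[OF that(2)]] bij_betwE[OF bij_betw_inv_into[OF assms[OF that(2)]]]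
      PiE_mem[OF that] by blast+
  then show "product_map \<Omega> f \<in> PiE \<Omega> X \<rightarrow> PiE \<Omega> X"
    and "product_map \<Omega> (\<lambda>\<alpha>. inv_into (X \<alpha>) (f \<alpha>)) \<in> PiE \<Omega> X \<rightarrow> PiE \<Omega> X"
    unfolding product_map_def by (simp_all add: restrict_PiE_iff)
next
  fix p assume p: "p \<in> PiE \<Omega> X"
  show "product_map \<Omega> (\<lambda>\<alpha>. inv_into (X \<alpha>) (f \<alpha>)) (product_map \<Omega> f p) = p"
  proof
    fix \<alpha> show "product_map \<Omega> (\<lambda>\<alpha>. inv_into (X \<alpha>) (f \<alpha>)) (product_map \<Omega> f p) \<alpha> = p \<alpha>"
      using PiE_mem[OF p, of \<alpha>] PiE_arb[OF p, of \<alpha>] bij_betw_inv_into_left[OF assms]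
      by (cases "\<alpha> \<in> \<Omega>") (simp_all add: product_map_def)
  qed
next
  fix p assume p: "p \<in> PiE \<Omega> X"
  show "product_map \<Omega> f (product_map \<Omega> (\<lambda>\<alpha>. inv_into (X \<alpha>) (f \<alpha>)) p) = p"
  proof
    fix \<alpha> show "product_map \<Omega> f (product_map \<Omega> (\<lambda>\<alpha>. inv_into (X \<alpha>) (f \<alpha>)) p) \<alpha> = p \<alpha>"
      using PiE_mem[OF p, of \<alpha>] PiE_arb[OF p, of \<alpha>] bij_betw_inv_into_right[OF assms]
      by (cases "\<alpha> \<in> \<Omega>") (simp_all add: product_map_def)
  qed
qed

lemma product_map_fun_upd:
  assumes "\<beta> \<in> \<Omega>"
  shows "product_map \<Omega> f (p(\<beta> := q)) = (product_map \<Omega> f p)(\<beta> := f \<beta> q)"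
  using assms by (auto simp: product_map_def restrict_def)

locale closure_space_family_permutations = closure_space_family \<Omega> X L
  for \<Omega> :: "'i set" and X :: "'i \<Rightarrow> 'a set" and L :: "'i \<Rightarrow> 'a set set" +
  fixes f :: "'i \<Rightarrow> 'a \<Rightarrow> 'a"
  assumes perm: "\<And>\<alpha>. \<alpha> \<in> \<Omega> \<Longrightarrow> bij_betw (f \<alpha>) (X \<alpha>) (X \<alpha>)"
    and perm_closed: "\<And>\<alpha>. \<alpha> \<in> \<Omega> \<Longrightarrow> (`) (f \<alpha>) ` L \<alpha> = L \<alpha>"
begin

lemma bij_product: "bij_betw (product_map \<Omega> f) (PiE \<Omega> X) (PiE \<Omega> X)"
  using perm by (rule bij_betw_product_map)

lemma image_slab:
  assumes "a \<in> PiE \<Omega> L"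
  shows "product_map \<Omega> f ` slab \<Omega> X a = slab \<Omega> X (\<lambda>\<alpha>\<in>\<Omega>. f \<alpha> ` a \<alpha>)"
proof -
  have mem: "product_map \<Omega> f p \<in> slab \<Omega> X (\<lambda>\<alpha>\<in>\<Omega>. f \<alpha> ` a \<alpha>) \<longleftrightarrow> p \<in> slab \<Omega> X a"
    if p: "p \<in> PiE \<Omega> X" for p
  proof -
    have "f \<alpha> (p \<alpha>) \<in> f \<alpha> ` a \<alpha> \<longleftrightarrow> p \<alpha> \<in> a \<alpha>" if "\<alpha> \<in> \<Omega>" for \<alpha>
    proof (rule inj_on_image_mem_iff)
      show "inj_on (f \<alpha>) (X \<alpha>)"
        using perm[OF that] by (rule bij_betw_imp_inj_on)
      show "p \<alpha> \<in> X \<alpha>"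
        using p that by (rule PiE_mem)
      show "a \<alpha> \<subseteq> X \<alpha>"
        using PiE_mem[OF assms that] closed_sets(2)[OF that] by blast
    qed
    moreover have "product_map \<Omega> f p \<in> PiE \<Omega> X"
      using bij_betwE[OF bij_product] p by blast
    moreover have "product_map \<Omega> f p \<alpha> = f \<alpha> (p \<alpha>)" if "\<alpha> \<in> \<Omega>" for \<alpha>
      using that by (simp add: product_map_def)
    ultimately show ?thesis
      using p by (simp add: slab_def)
  qed
  show ?thesis
  proof (intro subset_antisym subsetI)
    fix r assume "r \<in> product_map \<Omega> f ` slab \<Omega> X a"
    then obtain p where p: "p \<in> slab \<Omega> X a" "r = product_map \<Omega> f p" ..
    then show "r \<in> slab \<Omega> X (\<lambda>\<alpha>\<in>\<Omega>. f \<alpha> ` a \<alpha>)"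
      using mem[OF subsetD[OF slab_subset p(1)]] by simp
  next
    fix r assume r: "r \<in> slab \<Omega> X (\<lambda>\<alpha>\<in>\<Omega>. f \<alpha> ` a \<alpha>)"
    then have "r \<in> product_map \<Omega> f ` PiE \<Omega> X"
      using subsetD[OF slab_subset r] by (simp add: bij_betw_imp_surj_on[OF bij_product])
    then obtain p where p: "p \<in> PiE \<Omega> X" "r = product_map \<Omega> f p" ..
    then have "p \<in> slab \<Omega> X a"
      using mem r by simp
    then show "r \<in> product_map \<Omega> f ` slab \<Omega> X a"
      unfolding p(2) by (rule imageI)
  qed
qed

lemma image_slabs: "(`) (product_map \<Omega> f) ` slab \<Omega> X ` PiE \<Omega> L = slab \<Omega> X ` PiE \<Omega> L"
proof (intro subset_antisym subsetI)
  fix S assume "S \<in> (`) (product_map \<Omega> f) ` slab \<Omega> X ` PiE \<Omega> L"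
  then obtain a where a: "a \<in> PiE \<Omega> L" "S = slab \<Omega> X (\<lambda>\<alpha>\<in>\<Omega>. f \<alpha> ` a \<alpha>)"
    using image_slab by fastforce
  moreover have "f \<alpha> ` a \<alpha> \<in> L \<alpha>" if "\<alpha> \<in> \<Omega>" for \<alpha>
    using PiE_mem[OF a(1) that] perm_closed[OF that] by blast
  then have "(\<lambda>\<alpha>\<in>\<Omega>. f \<alpha> ` a \<alpha>) \<in> PiE \<Omega> L"
    by (simp add: restrict_PiE_iff)
  ultimately show "S \<in> slab \<Omega> X ` PiE \<Omega> L" by blast
next
  fix S assume "S \<in> slab \<Omega> X ` PiE \<Omega> L"
  then obtain b where b: "b \<in> PiE \<Omega> L" "S = slab \<Omega> X b" by blast
  have "\<exists>A\<in>L \<alpha>. b \<alpha> = f \<alpha> ` A" if "\<alpha> \<in> \<Omega>" for \<alpha>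
    using PiE_mem[OF b(1) that] perm_closed[OF that] by blast
  then obtain a where a: "\<forall>\<alpha>\<in>\<Omega>. a \<alpha> \<in> L \<alpha> \<and> b \<alpha> = f \<alpha> ` a \<alpha>" by metis
  then have a': "restrict a \<Omega> \<in> PiE \<Omega> L"
    by (simp add: restrict_PiE_iff)
  have "(\<lambda>\<alpha>\<in>\<Omega>. f \<alpha> ` restrict a \<Omega> \<alpha>) = b"
  proof
    fix \<alpha> show "(\<lambda>\<alpha>\<in>\<Omega>. f \<alpha> ` restrict a \<Omega> \<alpha>) \<alpha> = b \<alpha>"
      using a PiE_arb[OF b(1), of \<alpha>] by (cases "\<alpha> \<in> \<Omega>") simp_all
  qed
  then have "S = product_map \<Omega> f ` slab \<Omega> X (restrict a \<Omega>)"
    using image_slab[OF a'] b(2) by simp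
  then show "S \<in> (`) (product_map \<Omega> f) ` slab \<Omega> X ` PiE \<Omega> L"
    using a' by blast
qed

lemma lower_tensor_invariant:
  "(`) (product_map \<Omega> f) ` lower_tensor \<Omega> X L = lower_tensor \<Omega> X L"
proof -
  let ?g = "product_map \<Omega> f" and ?S = "slab \<Omega> X ` PiE \<Omega> L"
  have image_Inter: "?g ` (PiE \<Omega> X \<inter> \<Inter>W) = PiE \<Omega> X \<inter> \<Inter>((`) ?g ` W)" if W: "W \<subseteq> ?S" for W
  proof -
    have sub: "R \<subseteq> PiE \<Omega> X" if R: "R \<in> W" for R
    proof -
      obtain a where "R = slab \<Omega> X a"
        using subsetD[OF W R] by (rule imageE)
      then show ?thesis
        by (simp add: slab_subset)
    qed
    \<comment> \<open>Including the whole product makes the family nonempty even when \<open>W\<close> is empty; images under an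
      injective map commute with nonempty intersections.\<close>
    have "?g ` (\<Inter>R\<in>insert (PiE \<Omega> X) W. R) = (\<Inter>R\<in>insert (PiE \<Omega> X) W. ?g ` R)"
      using bij_betw_imp_inj_on[OF bij_product]
      by (rule image_INT[where j = "PiE \<Omega> X"]) (simp_all add: sub)
    then have "?g ` (PiE \<Omega> X \<inter> \<Inter>W) = ?g ` PiE \<Omega> X \<inter> \<Inter>((`) ?g ` W)"
      by (simp only: INT_insert image_ident Inter_insert)
    then show ?thesis
      by (simp only: bij_betw_imp_surj_on[OF bij_product])
  qed
  show ?thesis
  proof (intro subset_antisym subsetI)
    fix R assume "R \<in> (`) ?g ` lower_tensor \<Omega> X L"
    then obtain W where W: "W \<subseteq> ?S" "R = ?g ` (PiE \<Omega> X \<inter> \<Inter>W)"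
      by (auto simp: lower_tensor_def)
    then have "(`) ?g ` W \<subseteq> ?S"
      using image_mono[OF W(1), of "(`) ?g"] by (simp only: image_slabs)
    then show "R \<in> lower_tensor \<Omega> X L"
      unfolding W(2) image_Inter[OF W(1)] by (rule lower_tensorI)
  next
    fix R assume "R \<in> lower_tensor \<Omega> X L"
    then obtain V where V: "V \<subseteq> ?S" "R = PiE \<Omega> X \<inter> \<Inter>V"
      by (auto simp: lower_tensor_def)
    then have "V \<subseteq> (`) ?g ` ?S"
      by (simp only: image_slabs)
    then obtain W where W: "W \<subseteq> ?S" "V = (`) ?g ` W"
      by (rule subset_imageE)
    then have "R = ?g ` (PiE \<Omega> X \<inter> \<Inter>W)"
      using V(2) by (simp only: image_Inter)
    then show "R \<in> (`) ?g ` lower_tensor \<Omega> X L"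
      using lower_tensorI[OF W(1)] by (simp only: imageI)
  qed
qed

text \<open>A product permutation maps the line through \<open>p\<close> in direction \<open>\<beta>\<close> to the line through the image of
  \<open>p\<close>, acting along it as \<open>f \<beta>\<close>.\<close>

lemma section_at_image:
  assumes R: "R \<subseteq> PiE \<Omega> X" and p: "p \<in> PiE \<Omega> X" and \<beta>: "\<beta> \<in> \<Omega>"
  shows "section_at X (product_map \<Omega> f ` R) \<beta> (product_map \<Omega> f p) = f \<beta> ` section_at X R \<beta> p"
proof -
  have mem: "(product_map \<Omega> f p)(\<beta> := f \<beta> q) \<in> product_map \<Omega> f ` R \<longleftrightarrow> p(\<beta> := q) \<in> R"
    if "q \<in> X \<beta>" for q
    using inj_on_image_mem_iff[OF bij_betw_imp_inj_on[OF bij_product]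
        fun_upd_in_PiE[OF p \<beta> that] R]
    by (simp add: product_map_fun_upd[OF \<beta>])
  have X: "X \<beta> = f \<beta> ` X \<beta>"
    using bij_betw_imp_surj_on[OF perm[OF \<beta>]] by simp
  show ?thesis
    unfolding section_at_def by (subst X) (use mem in auto)
qed

lemma upper_tensor_invariant:
  "(`) (product_map \<Omega> f) ` upper_tensor \<Omega> X L = upper_tensor \<Omega> X L"
proof -
  let ?g = "product_map \<Omega> f"
  have surj: "?g ` PiE \<Omega> X = PiE \<Omega> X"
    using bij_product by (rule bij_betw_imp_surj_on)
  have "?g ` R \<in> upper_tensor \<Omega> X L \<longleftrightarrow> R \<in> upper_tensor \<Omega> X L" if R: "R \<subseteq> PiE \<Omega> X" for R
  proof -
    have reindex: "(\<forall>q\<in>PiE \<Omega> X. P q) \<longleftrightarrow> (\<forall>p\<in>PiE \<Omega> X. P (?g p))" for P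
      by (subst surj[symmetric]) blast
    have "section_at X (?g ` R) \<beta> (?g p) \<in> L \<beta> \<longleftrightarrow> section_at X R \<beta> p \<in> L \<beta>"
      if "p \<in> PiE \<Omega> X" "\<beta> \<in> \<Omega>" for p \<beta>
    proof -
      have "section_at X R \<beta> p \<subseteq> X \<beta>"
        by (auto simp: section_at_def)
      then show ?thesis
        using section_at_image[OF R that] perm_closed[OF that(2)]
          image_family_eq_iff[OF perm closed_sets(2), OF that(2) that(2)] by simp
    qed
    moreover have "?g ` R \<subseteq> PiE \<Omega> X"
      using R surj by blast
    ultimately show ?thesis
      using R by (simp add: upper_tensor_def reindex[of "\<lambda>q. \<forall>\<beta>\<in>\<Omega>. section_at X (?g ` R) \<beta> q \<in> L \<beta>"])
  qed
  then show ?thesis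
    by (subst image_family_eq_iff[OF bij_product]) (auto simp: upper_tensor_def)
qed

end

section \<open>Equivariant weak tensor products\<close>

context closure_space_family
begin

lemma product_automorphism_permutations:
  assumes T: "\<And>\<alpha>. \<alpha> \<in> \<Omega> \<Longrightarrow> T \<alpha> \<subseteq> lattice_aut (L \<alpha>)" and v: "v \<in> PiE \<Omega> T"
  shows "closure_space_family_permutations \<Omega> X L (\<lambda>\<alpha>. point_map (v \<alpha>))"
proof unfold_locales
  fix \<alpha> assume \<alpha>: "\<alpha> \<in> \<Omega>"
  then have aut: "v \<alpha> \<in> lattice_aut (L \<alpha>)"
    using PiE_mem[OF v \<alpha>] T[OF \<alpha>] by blast
  show "bij_betw (point_map (v \<alpha>)) (X \<alpha>) (X \<alpha>)"
    using closure_space[OF \<alpha>] aut by (rule lattice_aut_is_image(1))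
  show "(`) (point_map (v \<alpha>)) ` L \<alpha> = L \<alpha>"
    using closure_space[OF \<alpha>] aut by (rule lattice_aut_image_closed_sets)
qed

text \<open>This removes the existential quantifier over automorphisms: the automorphism is forced by its
  action on points, and only the invariance of the closed sets remains.\<close>

lemma equivariant_weak_tensors_eq:
  assumes T: "\<And>\<alpha>. \<alpha> \<in> \<Omega> \<Longrightarrow> T \<alpha> \<subseteq> lattice_aut (L \<alpha>)"
  shows "equivariant_weak_tensors \<Omega> X L (PiE \<Omega> T) =
    {M \<in> weak_tensors \<Omega> X L.
       \<forall>v\<in>PiE \<Omega> T. (`) (product_map \<Omega> (\<lambda>\<alpha>. point_map (v \<alpha>))) ` M = M}"
proof -
  have induced: "(\<exists>u\<in>lattice_aut M. \<forall>p\<in>PiE \<Omega> X. \<forall>\<alpha>\<in>\<Omega>. point_map u p \<alpha> = point_map (v \<alpha>) (p \<alpha>)) \<longleftrightarrow>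
        (`) (product_map \<Omega> (\<lambda>\<alpha>. point_map (v \<alpha>))) ` M = M"
    if M: "M \<in> weak_tensors \<Omega> X L" and v: "v \<in> PiE \<Omega> T" for M v
  proof -
    let ?g = "product_map \<Omega> (\<lambda>\<alpha>. point_map (v \<alpha>))"
    interpret closure_space_family_permutations \<Omega> X L "\<lambda>\<alpha>. point_map (v \<alpha>)"
      using T v by (rule product_automorphism_permutations)
    have sp: "simple_closure_space (PiE \<Omega> X) M"
      using M by (simp add: weak_tensors_def)
    \<comment> \<open>Points are extensional functions, so agreement on \<open>\<Omega>\<close> is equality.\<close>
    have pointwise: "(\<forall>\<alpha>\<in>\<Omega>. point_map u p \<alpha> = point_map (v \<alpha>) (p \<alpha>)) \<longleftrightarrow> point_map u p = ?g p"
      if "u \<in> lattice_aut M" "p \<in> PiE \<Omega> X" for u p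
    proof -
      have "point_map u p \<in> PiE \<Omega> X"
        using bij_betwE[OF lattice_aut_is_image(1)[OF sp that(1)]] that(2) by blast
      moreover have "?g p \<in> PiE \<Omega> X"
        using bij_betwE[OF bij_product] that(2) by blast
      ultimately have "(\<forall>\<alpha>\<in>\<Omega>. point_map u p \<alpha> = ?g p \<alpha>) \<longleftrightarrow> point_map u p = ?g p"
        by (auto intro: PiE_ext)
      moreover have "?g p \<alpha> = point_map (v \<alpha>) (p \<alpha>)" if "\<alpha> \<in> \<Omega>" for \<alpha>
        using that by (simp add: product_map_def)
      ultimately show ?thesis
        by (simp cong: ball_cong_simp)
    qed
    show ?thesis
      unfolding lattice_aut_inducing_iff[OF sp bij_product, symmetric]
      by (intro bex_cong ball_cong refl pointwise)
  qed
  show ?thesis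
    unfolding equivariant_weak_tensors_def by (intro Collect_cong conj_cong ball_cong refl induced)
qed

lemma tensors_equivariant:
  assumes T: "\<And>\<alpha>. \<alpha> \<in> \<Omega> \<Longrightarrow> T \<alpha> \<subseteq> lattice_aut (L \<alpha>)"
  shows "lower_tensor \<Omega> X L \<in> equivariant_weak_tensors \<Omega> X L (PiE \<Omega> T)"
    and "upper_tensor \<Omega> X L \<in> equivariant_weak_tensors \<Omega> X L (PiE \<Omega> T)"
proof -
  have eq: "equivariant_weak_tensors \<Omega> X L (PiE \<Omega> T) =
    {M \<in> weak_tensors \<Omega> X L.
       \<forall>v\<in>PiE \<Omega> T. (`) (product_map \<Omega> (\<lambda>\<alpha>. point_map (v \<alpha>))) ` M = M}"
    using T by (rule equivariant_weak_tensors_eq)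
  have perms: "closure_space_family_permutations \<Omega> X L (\<lambda>\<alpha>. point_map (v \<alpha>))"
    if "v \<in> PiE \<Omega> T" for v
    using T that by (rule product_automorphism_permutations)
  show "lower_tensor \<Omega> X L \<in> equivariant_weak_tensors \<Omega> X L (PiE \<Omega> T)"
    using lower_tensor_is_weak_tensor perms[THEN closure_space_family_permutations.lower_tensor_invariant]
    by (simp add: eq)
  show "upper_tensor \<Omega> X L \<in> equivariant_weak_tensors \<Omega> X L (PiE \<Omega> T)"
    using upper_tensor_is_weak_tensor perms[THEN closure_space_family_permutations.upper_tensor_invariant]
    by (simp add: eq)
qed

text \<open>The automorphisms of the members of \<open>W\<close> that realise \<open>v\<close> are different maps, but they all induce
  the same permutation of the points. This one permutation preserves every member, hence also the
  intersection.\<close>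

lemma equivariant_weak_tensors_Inter:
  assumes T: "\<And>\<alpha>. \<alpha> \<in> \<Omega> \<Longrightarrow> T \<alpha> \<subseteq> lattice_aut (L \<alpha>)"
    and W: "W \<subseteq> equivariant_weak_tensors \<Omega> X L (PiE \<Omega> T)" "W \<noteq> {}"
  shows "\<Inter>W \<in> equivariant_weak_tensors \<Omega> X L (PiE \<Omega> T)"
proof -
  have eq: "equivariant_weak_tensors \<Omega> X L (PiE \<Omega> T) =
    {M \<in> weak_tensors \<Omega> X L.
       \<forall>v\<in>PiE \<Omega> T. (`) (product_map \<Omega> (\<lambda>\<alpha>. point_map (v \<alpha>))) ` M = M}"
    using T by (rule equivariant_weak_tensors_eq)
  have weak: "W \<subseteq> weak_tensors \<Omega> X L"
    using W(1) by (auto simp: equivariant_weak_tensors_def)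
  have "(`) (product_map \<Omega> (\<lambda>\<alpha>. point_map (v \<alpha>))) ` \<Inter>W = \<Inter>W" if v: "v \<in> PiE \<Omega> T" for v
  proof -
    let ?g = "product_map \<Omega> (\<lambda>\<alpha>. point_map (v \<alpha>))"
    interpret closure_space_family_permutations \<Omega> X L "\<lambda>\<alpha>. point_map (v \<alpha>)"
      using T v by (rule product_automorphism_permutations)
    have sub: "M \<subseteq> Pow (PiE \<Omega> X)" if "M \<in> W" for M
      using weak that by (intro simple_closure_spaceD(2)) (auto simp: weak_tensors_def)
    have inv: "(`) ?g ` M = M" if "M \<in> W" for M
      using W(1) that v unfolding eq by blast
    obtain M where "M \<in> W"
      using W(2) by blast
    have "(`) ?g ` (\<Inter>M\<in>W. M) = (\<Inter>M\<in>W. (`) ?g ` M)"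
      using inj_on_image_Pow[OF bij_betw_imp_inj_on[OF bij_product]] _ \<open>M \<in> W\<close>
      by (rule image_INT) (simp add: sub)
    also have "\<dots> = (\<Inter>M\<in>W. M)"
      by (intro INF_cong refl inv)
    finally show ?thesis
      by (simp only: image_ident)
  qed
  then show ?thesis
    using weak_tensors_Inter[OF weak W(2)] by (simp add: eq)
qed

end

theorem theorem2p12:
  fixes \<Omega> :: "'i set"
    and X :: "'i \<Rightarrow> 'a set"
    and L :: "'i \<Rightarrow> 'a set set"
    and T :: "'i \<Rightarrow> ('a set \<Rightarrow> 'a set) set"
  assumes "\<And>\<alpha>. \<alpha> \<in> \<Omega> \<Longrightarrow> simple_closure_space (X \<alpha>) (L \<alpha>)"
    and "\<And>\<alpha>. \<alpha> \<in> \<Omega> \<Longrightarrow> T \<alpha> \<subseteq> lattice_aut (L \<alpha>)"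
  shows "(simple_closure_space (PiE \<Omega> X) (lower_tensor \<Omega> X L) \<and>
          simple_closure_space (PiE \<Omega> X) (upper_tensor \<Omega> X L)) \<and>
         (lower_tensor \<Omega> X L \<in> equivariant_weak_tensors \<Omega> X L (PiE \<Omega> T) \<and>
          upper_tensor \<Omega> X L \<in> equivariant_weak_tensors \<Omega> X L (PiE \<Omega> T)) \<and>
         weak_tensors \<Omega> X L =
           {M. simple_closure_space (PiE \<Omega> X) M \<and>
               lower_tensor \<Omega> X L \<subseteq> M \<and> M \<subseteq> upper_tensor \<Omega> X L} \<and>
         (complete_lattice (inclusion_order (equivariant_weak_tensors \<Omega> X L (PiE \<Omega> T))) \<and>
          complete_lattice (inclusion_order (weak_tensors \<Omega> X L)))"
proof -
  interpret closure_space_family \<Omega> X L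
    using assms(1) by unfold_locales
  have "complete_lattice (inclusion_order (equivariant_weak_tensors \<Omega> X L (PiE \<Omega> T)))"
  proof (rule complete_lattice_inclusion_order)
    show "upper_tensor \<Omega> X L \<in> equivariant_weak_tensors \<Omega> X L (PiE \<Omega> T)"
      using assms(2) by (rule tensors_equivariant(2))
    show "M \<subseteq> upper_tensor \<Omega> X L" if "M \<in> equivariant_weak_tensors \<Omega> X L (PiE \<Omega> T)" for M
      using that weak_tensor_subset_upper_tensor by (auto simp: equivariant_weak_tensors_def)
    show "\<Inter>W \<in> equivariant_weak_tensors \<Omega> X L (PiE \<Omega> T)"
      if "W \<subseteq> equivariant_weak_tensors \<Omega> X L (PiE \<Omega> T)" "W \<noteq> {}" for W
      using assms(2) that by (rule equivariant_weak_tensors_Inter)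
  qed
  moreover have "complete_lattice (inclusion_order (weak_tensors \<Omega> X L))"
    using upper_tensor_is_weak_tensor weak_tensor_subset_upper_tensor weak_tensors_Inter
    by (rule complete_lattice_inclusion_order)
  moreover have "lower_tensor \<Omega> X L \<in> equivariant_weak_tensors \<Omega> X L (PiE \<Omega> T)"
    using assms(2) by (rule tensors_equivariant(1))
  moreover have "upper_tensor \<Omega> X L \<in> equivariant_weak_tensors \<Omega> X L (PiE \<Omega> T)"
    using assms(2) by (rule tensors_equivariant(2))
  ultimately show ?thesis
    by (intro conjI lower_tensor_closure_space upper_tensor_closure_space weak_tensors_eq_interval)
qed

end
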